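(* For every bipartite permutation graph $G$, both the convex obstacle number and the disjoint convex obstacle number of $G$ are at most $4$.
   Context: A permutation graph is a graph on vertex set $[n]=\{1,\dots,n\}$ determined by a permutation $(\sigma_1,\dots,\sigma_n)$ of $[n]$, in which there is an edge between $\sigma_i$ and $\sigma_j$ whenever $i<j$ and $\sigma_i>\sigma_j$. A bipartite permutation graph is a permutation graph that is bipartite. An obstacle representation of a graph $G$ consists of an injective placement of the vertices of $G$ as points in the plane together with a set of polygons (obstacles), such that the vertex points together with the polygon vertices are in general position (no three collinear), and two vertices $u,v$ are adjacent in $G$ if and only if the segment $\overline{uv}$ does not meet any obstacle. The convex obstacle number of $G$ is the smallest number of obstacles in an obstacle representation of $G$ with all obstacles convex polygons; the disjoint convex obstacle number is the same with the obstacles additionally required to be pairwise disjoint. *)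

theory Defs
  imports "HOL-Analysis.Analysis" "HOL-Combinatorics.Permutations"
begin

text \<open>A finite simple graph is given by a vertex set \<open>V\<close> and a set \<open>E\<close> of two-element edges.
  The sequence of the permutation is \<open>\<sigma> 1, \<dots>, \<sigma> n\<close>, and its \<^emph>\<open>values\<close> are the
  vertices.\<close>

definition permutation_graph_edges :: "nat \<Rightarrow> (nat \<Rightarrow> nat) \<Rightarrow> nat set set" where
  "permutation_graph_edges n \<sigma> =
     {{\<sigma> i, \<sigma> j} | i j. i \<in> {1..n} \<and> j \<in> {1..n} \<and> i < j \<and> \<sigma> i > \<sigma> j}"

definition permutation_graph :: "nat set \<Rightarrow> nat set set \<Rightarrow> bool" where
  "permutation_graph V E \<longleftrightarrow>
     (\<exists>n \<sigma>. \<sigma> permutes {1..n} \<and> V = {1..n} \<and> E = permutation_graph_edges n \<sigma>)"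

definition bipartite_graph :: "'a set \<Rightarrow> 'a set set \<Rightarrow> bool" where
  "bipartite_graph V E \<longleftrightarrow>
     (\<exists>A B. A \<union> B = V \<and> A \<inter> B = {} \<and> (\<forall>e\<in>E. \<exists>a\<in>A. \<exists>b\<in>B. e = {a, b}))"

definition bipartite_permutation_graph :: "nat set \<Rightarrow> nat set set \<Rightarrow> bool" where
  "bipartite_permutation_graph V E \<longleftrightarrow> permutation_graph V E \<and> bipartite_graph V E"

text \<open>Polygons are closed, non-degenerate regions; their vertices are their extreme points.\<close>

definition convex_polygon :: "(real^2) set \<Rightarrow> bool" where
  "convex_polygon P \<longleftrightarrow> polytope P \<and> aff_dim P = 2"

definition polygon_vertices :: "(real^2) set \<Rightarrow> (real^2) set" where
  "polygon_vertices P = {x. x extreme_point_of P}"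

definition general_position :: "(real^2) set \<Rightarrow> bool" where
  "general_position S \<longleftrightarrow> (\<forall>T\<subseteq>S. card T = 3 \<longrightarrow> \<not> collinear T)"

definition convex_obstacle_representation ::
    "'a set \<Rightarrow> 'a set set \<Rightarrow> ('a \<Rightarrow> real^2) \<Rightarrow> (real^2) set set \<Rightarrow> bool" where
  "convex_obstacle_representation V E p Obs \<longleftrightarrow>
     inj_on p V \<and>
     finite Obs \<and>
     (\<forall>P\<in>Obs. convex_polygon P) \<and>
     general_position (p ` V \<union> (\<Union>P\<in>Obs. polygon_vertices P)) \<and>
     (\<forall>u\<in>V. \<forall>v\<in>V. u \<noteq> v \<longrightarrow>
        ({u, v} \<in> E \<longleftrightarrow> (\<forall>P\<in>Obs. closed_segment (p u) (p v) \<inter> P = {})))"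

text \<open>The minima are taken in \<^typ>\<open>enat\<close>, so that a graph without a representation would have
  obstacle number \<open>\<infinity>\<close>.\<close>

definition convex_obstacle_number :: "'a set \<Rightarrow> 'a set set \<Rightarrow> enat" where
  "convex_obstacle_number V E =
     Inf {enat (card Obs) | p Obs. convex_obstacle_representation V E p Obs}"

definition disjoint_convex_obstacle_number :: "'a set \<Rightarrow> 'a set set \<Rightarrow> enat" where
  "disjoint_convex_obstacle_number V E =
     Inf {enat (card Obs) | p Obs.
       convex_obstacle_representation V E p Obs \<and> pairwise disjnt Obs}"

end

theory Submission imports Defs begin

text \<open>Call the left-to-right maxima of the permutation \<open>A\<close> and the remaining positions \<open>B\<close>. As the
  graph is triangle free, the permutation is increasing on both. Assigning reals to the positions
  from left to right, one obtains coordinates \<open>x\<close> such that \<open>a \<in> A\<close> and \<open>b \<in> B\<close> are adjacent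
  if \<open>\<bar>x a - x b\<bar> < 1\<close> and \<open>\<bar>x a - x b\<bar> > 1\<close> otherwise. Place \<open>a\<close> at \<open>(x a, M + (x a)\<^sup>2)\<close> and \<open>b\<close>
  at \<open>- (x b, M + (x b)\<^sup>2)\<close>. For large \<open>M\<close> the segment from \<open>a\<close> to \<open>b\<close> crosses the horizontal axis
  close to \<open>(x a - x b) / 2\<close>, so two obstacles (walls) on the axis, to the right of \<open>1/2\<close> and to the
  left of \<open>- 1/2\<close>, block exactly the nonadjacent pairs. Two more obstacles (caps), one inside each
  parabola, block the chords within \<open>A\<close> and within \<open>B\<close>. All incidences involved are stable, so a
  small perturbation puts everything into general position.\<close>

section \<open>Unit coordinates\<close>

lemma finite_sets_separating_real:
  fixes L U :: "real set"
  assumes "finite L" "finite U" "\<And>l u. l \<in> L \<Longrightarrow> u \<in> U \<Longrightarrow> l < u"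
  shows "\<exists>y. (\<forall>l\<in>L. l < y) \<and> (\<forall>u\<in>U. y < u)"
proof (cases "L = {} \<or> U = {}")
  case True
  obtain c where "\<forall>l\<in>L. l \<le> c"
    using assms(1) bdd_above_finite unfolding bdd_above_def by blast
  moreover obtain d where "\<forall>u\<in>U. d \<le> u"
    using assms(2) bdd_below_finite unfolding bdd_below_def by blast
  ultimately have "(\<forall>l\<in>L. l < c + 1) \<and> (\<forall>u\<in>U. d - 1 < u)"
    by force
  then show ?thesis
    using True by blast
next
  case False
  then have "Max L < Min U"
    using assms by simp
  then obtain y where "Max L < y" "y < Min U"
    using dense by blast
  then show ?thesis
    using assms(1,2) False by (intro exI[of _ y]) auto
qed

text \<open>The bound \<open>x k < x i + 2\<close> keeps room for a common neighbour of \<open>i\<close> and \<open>k\<close> to be placed later.\<close>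

lemma unit_coordinates:
  fixes \<sigma> :: "nat \<Rightarrow> nat"
  assumes inj: "inj \<sigma>"
    and up: "strict_mono_on A \<sigma>" and low: "strict_mono_on (- A) \<sigma>"
  shows "\<exists>x :: nat \<Rightarrow> real. \<forall>k<m. \<forall>i<k.
    (i \<in> A \<and> k \<in> A \<longrightarrow> x i < x k \<and> ((\<forall>j<k. j \<notin> A \<longrightarrow> \<sigma> j < \<sigma> i) \<longrightarrow> x k < x i + 2)) \<and>
    (i \<notin> A \<and> k \<notin> A \<longrightarrow> x i < x k) \<and>
    (i \<in> A \<and> k \<notin> A \<longrightarrow> (if \<sigma> k < \<sigma> i then \<bar>x i - x k\<bar> < 1 else x i + 1 < x k)) \<and>
    (i \<notin> A \<and> k \<in> A \<longrightarrow> x i + 1 < x k)"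
    (is "\<exists>x. \<forall>k<m. \<forall>i<k. ?good x k i")
proof (induction m)
  case 0
  show ?case by simp
next
  case (Suc m)
  then obtain x where x: "\<And>k i. k < m \<Longrightarrow> i < k \<Longrightarrow> ?good x k i"
    by blast
  have A_less: "x i < x k" if "i < k" "k < m" "i \<in> A" "k \<in> A" for i k
    using x[OF that(2,1)] that by simp
  \<comment> \<open>The bound is extended to \<open>k \<le> i\<close>, where it follows from
    monotonicity of \<open>x\<close> on \<open>A\<close>. The premise on \<open>j\<close> leaves
    open that a later position outside \<open>A\<close> is adjacent to both \<open>i\<close> and
    \<open>k\<close>.\<close>
  have A_close: "x k < x i + 2"
    if "i < m" "k < m" "i \<in> A" "k \<in> A" "\<And>j. j < k \<Longrightarrow> j \<notin> A \<Longrightarrow> \<sigma> j < \<sigma> i" for i k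
  proof (cases "i < k")
    case True
    then show ?thesis using x[of k i] that by simp
  next
    case False
    then have "k = i \<or> k < i" by auto
    then show ?thesis using A_less[of k i] that by fastforce
  qed
  \<comment> \<open>If \<open>j\<close> comes first, then even \<open>x j + 1 < x s\<close>;
    otherwise \<open>s\<close> and \<open>j\<close> form an inversion and have distance below
    1.\<close>
  have B_less: "x j < x s + 1" if "j < m" "s < m" "j \<notin> A" "s \<in> A" "\<sigma> j < \<sigma> s" for j s
  proof (cases "j < s")
    case True
    then show ?thesis using x[of s j] that by simp
  next
    case False
    then have "s < j" using that by (metis linorder_neqE_nat)
    then show ?thesis using x[of j s] that by simp
  qed
  have "\<exists>y. \<forall>i<m. ?good (x(m := y)) m i"
  proof (cases "m \<in> A")
    case True
    \<comment> \<open>\<open>L\<close> and \<open>U\<close> collect the bounds that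
      \<open>?good\<close> imposes on the new coordinate. It remains to see that every lower bound
      is below every upper bound.\<close>
    define L where "L = x ` {i. i < m \<and> i \<in> A} \<union> (\<lambda>i. x i + 1) ` {i. i < m \<and> i \<notin> A}"
    define U where "U = (\<lambda>i. x i + 2) ` {i. i < m \<and> i \<in> A \<and> (\<forall>j<m. j \<notin> A \<longrightarrow> \<sigma> j < \<sigma> i)}"
    have "l < u" if lu: "l \<in> L" "u \<in> U" for l u
    proof -
      obtain s where s: "s < m" "s \<in> A" "\<forall>j<m. j \<notin> A \<longrightarrow> \<sigma> j < \<sigma> s" "u = x s + 2"
        using lu unfolding U_def by auto
      obtain i where i: "i < m" "i \<in> A \<and> l = x i \<or> i \<notin> A \<and> l = x i + 1"
        using lu unfolding L_def by auto
      then show ?thesis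
        using A_close[of s i] B_less[of i s] s by fastforce
    qed
    then obtain y where "\<forall>l\<in>L. l < y" "\<forall>u\<in>U. y < u"
      using finite_sets_separating_real[of L U] by (auto simp: L_def U_def)
    then show ?thesis
      using True by (intro exI[of _ y]) (auto simp: L_def U_def)
  next
    case False
    \<comment> \<open>The new coordinate must exceed those of earlier positions outside
      \<open>A\<close>, be more than 1 to the right of non-neighbours in \<open>A\<close>, and lie
      within 1 of each neighbour in \<open>A\<close>.\<close>
    define L where "L = x ` {i. i < m \<and> i \<notin> A} \<union> (\<lambda>i. x i + 1) ` {i. i < m \<and> i \<in> A \<and> \<sigma> i < \<sigma> m}
      \<union> (\<lambda>i. x i - 1) ` {i. i < m \<and> i \<in> A \<and> \<sigma> m < \<sigma> i}"
    define U where "U = (\<lambda>i. x i + 1) ` {i. i < m \<and> i \<in> A \<and> \<sigma> m < \<sigma> i}"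
    have low_m: "\<sigma> j < \<sigma> m" if "j < m" "j \<notin> A" for j
      using low that False by (auto simp: strict_mono_on_def)
    have "l < u" if lu: "l \<in> L" "u \<in> U" for l u
    proof -
      obtain s where s: "s < m" "s \<in> A" "\<sigma> m < \<sigma> s" "u = x s + 1"
        using lu unfolding U_def by auto
      consider i where "i < m" "i \<notin> A" "l = x i"
        | i where "i < m" "i \<in> A" "\<sigma> i < \<sigma> m" "l = x i + 1"
        | i where "i < m" "i \<in> A" "\<sigma> m < \<sigma> i" "l = x i - 1"
        using lu unfolding L_def by auto
      then show ?thesis
      proof cases
        case 1
        then show ?thesis using B_less[of i s] low_m[of i] s by simp
      next
        case 2
        then have "\<sigma> i < \<sigma> s" using s by simp
        then have "i < s"
          using up 2 s by (metis strict_mono_on_def linorder_neqE_nat not_less_iff_gr_or_eq)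
        then show ?thesis using A_less[of i s] 2 s by simp
      next
        case 3
        \<comment> \<open>Here \<open>i\<close> and \<open>s\<close> are both neighbours of
          \<open>m\<close>. As \<open>\<sigma>\<close> increases outside \<open>A\<close>, all
          earlier values there are below \<open>\<sigma> m < \<sigma> s\<close>, which is the
          premise of \<open>A_close\<close>.\<close>
        have "x i < x s + 2"
        proof (rule A_close)
          show "\<sigma> j < \<sigma> s" if "j < i" "j \<notin> A" for j
            using low_m[of j] that 3 s by simp
        qed (use 3 s in auto)
        then show ?thesis using 3 s by simp
      qed
    qed
    then obtain y where y: "\<forall>l\<in>L. l < y" "\<forall>u\<in>U. y < u"
      using finite_sets_separating_real[of L U] by (auto simp: L_def U_def)
    have "?good (x(m := y)) m i" if "i < m" for i
    proof (cases "i \<in> A \<and> \<sigma> m < \<sigma> i")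
      case True
      then have "x i - 1 < y" "y < x i + 1"
        using y that by (auto simp: L_def U_def)
      then show ?thesis using True False that by (auto simp: abs_less_iff)
    next
      case F: False
      have "\<sigma> i \<noteq> \<sigma> m" using inj that by (metis injD less_irrefl)
      then have "i \<in> A \<Longrightarrow> x i + 1 < y" "i \<notin> A \<Longrightarrow> x i < y"
        using y that F by (auto simp: L_def)
      then show ?thesis using F False that by auto
    qed
    then show ?thesis by blast
  qed
  then obtain y where y: "\<And>i. i < m \<Longrightarrow> ?good (x(m := y)) m i"
    by blast
  have "?good (x(m := y)) k i" if "k < Suc m" "i < k" for k i
  proof (cases "k = m")
    case True
    show ?thesis unfolding True by (rule y) (use that True in simp)
  next
    case False
    then have "k < m" and eq: "(x(m := y)) k = x k" "(x(m := y)) i = x i"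
      using that by auto
    then show ?thesis unfolding eq by (intro x that)
  qed
  then show ?case by (intro exI[of _ "x(m := y)"] allI impI)
qed

section \<open>From permutations to unit coordinates of the vertices\<close>

lemma bipartite_graph_triangle_free:
  assumes "bipartite_graph V E" "{u, v} \<in> E" "{v, w} \<in> E" "{u, w} \<in> E"
  shows False
proof -
  obtain A B where AB: "A \<inter> B = {}" "\<forall>e\<in>E. \<exists>a\<in>A. \<exists>b\<in>B. e = {a, b}"
    using assms(1) unfolding bipartite_graph_def by blast
  have "(p \<in> A \<and> q \<in> B) \<or> (p \<in> B \<and> q \<in> A)" if "{p, q} \<in> E" for p q
    using AB(2) that by (fastforce simp: doubleton_eq_iff)
  from this[OF assms(2)] this[OF assms(3)] this[OF assms(4)] show False
    using AB(1) by blast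
qed

text \<open>No range condition on \<open>i\<close> and \<open>j\<close> is required: outside
  \<open>{1..n}\<close> the permutation is the identity, so no inversion involves such a
  position.\<close>

lemma permutation_graph_edge_iff:
  assumes "\<sigma> permutes {1..n}" "i < j"
  shows "{\<sigma> i, \<sigma> j} \<in> permutation_graph_edges n \<sigma> \<longleftrightarrow> \<sigma> j < \<sigma> i"
proof
  assume "{\<sigma> i, \<sigma> j} \<in> permutation_graph_edges n \<sigma>"
  then obtain k l where kl: "{\<sigma> i, \<sigma> j} = {\<sigma> k, \<sigma> l}" "k < l" "\<sigma> l < \<sigma> k"
    unfolding permutation_graph_edges_def by blast
  then have "(i = k \<and> j = l) \<or> (i = l \<and> j = k)"
    using permutes_inj[OF assms(1)] by (simp add: doubleton_eq_iff inj_eq)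
  then show "\<sigma> j < \<sigma> i" using kl assms(2) by auto
next
  assume less: "\<sigma> j < \<sigma> i"
  have "j \<in> {1..n}"
  proof (rule ccontr)
    assume "j \<notin> {1..n}"
    then have "\<sigma> j = j" "n < j" using permutes_not_in[OF assms(1)] assms(2) by auto
    then have "\<sigma> i \<notin> {1..n}" using less by auto
    then have "\<sigma> i = i"
      using assms(1) by (metis permutes_in_image permutes_not_in)
    then show False using less assms(2) \<open>\<sigma> j = j\<close> by simp
  qed
  moreover have "i \<in> {1..n}"
  proof (rule ccontr)
    assume "i \<notin> {1..n}"
    then have "\<sigma> i = i" "i = 0"
      using permutes_not_in[OF assms(1), of i] \<open>j \<in> {1..n}\<close> assms(2) by auto
    then show False using less by simp
  qed
  ultimately show "{\<sigma> i, \<sigma> j} \<in> permutation_graph_edges n \<sigma>"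
    using less assms(2) unfolding permutation_graph_edges_def by blast
qed

text \<open>The value 1 is excluded on both sides because segments cross the axis only approximately
  at half the coordinate difference. Distinct coordinates within a class make the chords of a
  parabola non-degenerate.\<close>

definition unit_bigraph :: "'a set \<Rightarrow> 'a set set \<Rightarrow> 'a set \<Rightarrow> ('a \<Rightarrow> real) \<Rightarrow> bool" where
  "unit_bigraph V E A x \<longleftrightarrow>
     (\<forall>u\<in>V. \<forall>v\<in>V. u \<noteq> v \<longrightarrow>
       ((u \<in> A \<longleftrightarrow> v \<in> A) \<longrightarrow> {u, v} \<notin> E \<and> x u \<noteq> x v) \<and>
       (\<not> (u \<in> A \<longleftrightarrow> v \<in> A) \<longrightarrow>
          (if {u, v} \<in> E then \<bar>x u - x v\<bar> < 1 else \<bar>x u - x v\<bar> > 1)))"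

text \<open>Coordinates are found for positions, while the vertices are values, so class and
  coordinates are transported along \<open>\<sigma>\<close>. A left-to-right maximum is never the
  later end of an inversion, which fits the gap above 1 before each later position in
  \<open>A\<close>.\<close>

lemma bipartite_permutation_graph_imp_unit_bigraph:
  assumes "bipartite_permutation_graph V E"
  shows "finite V \<and> (\<exists>A x. unit_bigraph V E A x)"
proof -
  obtain n \<sigma> where \<sigma>: "\<sigma> permutes {1..n}" and V: "V = {1..n}" and E: "E = permutation_graph_edges n \<sigma>"
    using assms unfolding bipartite_permutation_graph_def permutation_graph_def by blast
  have edge: "{\<sigma> i, \<sigma> j} \<in> E \<longleftrightarrow> \<sigma> j < \<sigma> i" if "i < j" for i j
    using permutation_graph_edge_iff[OF \<sigma> that] E by simp
  have inj: "inj \<sigma>" using permutes_inj[OF \<sigma>] .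
  define A where "A = {i. \<forall>j<i. \<sigma> j < \<sigma> i}"
  have up: "strict_mono_on A \<sigma>"
    by (auto simp: strict_mono_on_def A_def)
  have low: "strict_mono_on (- A) \<sigma>"
  proof (rule strict_mono_onI)
    fix i k assume ik: "i \<in> - A" "k \<in> - A" "i < k"
    \<comment> \<open>An earlier larger value \<open>\<sigma> j\<close> extends any inversion of
      \<open>i\<close> and \<open>k\<close> to a triangle.\<close>
    then obtain j where j: "j < i" "\<not> \<sigma> j < \<sigma> i" unfolding A_def by auto
    then have "\<sigma> i < \<sigma> j" using inj_eq[OF inj, of i j] by simp
    show "\<sigma> i < \<sigma> k"
    proof (rule ccontr)
      assume "\<not> \<sigma> i < \<sigma> k"
      then have "\<sigma> k < \<sigma> i" using inj_eq[OF inj, of i k] ik by simp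
      then have "{\<sigma> j, \<sigma> i} \<in> E" "{\<sigma> i, \<sigma> k} \<in> E" "{\<sigma> j, \<sigma> k} \<in> E"
        using edge[of j i] edge[of i k] edge[of j k] j ik \<open>\<sigma> i < \<sigma> j\<close> by auto
      then show False
        using bipartite_graph_triangle_free[of V E "\<sigma> j" "\<sigma> i" "\<sigma> k"] assms unfolding bipartite_permutation_graph_def by blast
    qed
  qed
  obtain x :: "nat \<Rightarrow> real" where x: "\<And>k i. k < Suc n \<Longrightarrow> i < k \<Longrightarrow>
    (i \<in> A \<and> k \<in> A \<longrightarrow> x i < x k \<and> ((\<forall>j<k. j \<notin> A \<longrightarrow> \<sigma> j < \<sigma> i) \<longrightarrow> x k < x i + 2)) \<and>
    (i \<notin> A \<and> k \<notin> A \<longrightarrow> x i < x k) \<and>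
    (i \<in> A \<and> k \<notin> A \<longrightarrow> (if \<sigma> k < \<sigma> i then \<bar>x i - x k\<bar> < 1 else x i + 1 < x k)) \<and>
    (i \<notin> A \<and> k \<in> A \<longrightarrow> x i + 1 < x k)"
    using unit_coordinates[OF inj up low, of "Suc n"] by blast
  define y where "y v = x (inv \<sigma> v)" for v
  have y: "y (\<sigma> i) = x i" for i using inj by (simp add: y_def)
  have mem: "\<sigma> i \<in> \<sigma> ` A \<longleftrightarrow> i \<in> A" for i using inj by (simp add: inj_image_mem_iff)
  define P where "P u v \<longleftrightarrow> ((u \<in> \<sigma> ` A \<longleftrightarrow> v \<in> \<sigma> ` A) \<longrightarrow> {u, v} \<notin> E \<and> y u \<noteq> y v) \<and>
       (\<not> (u \<in> \<sigma> ` A \<longleftrightarrow> v \<in> \<sigma> ` A) \<longrightarrow>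
          (if {u, v} \<in> E then \<bar>y u - y v\<bar> < 1 else \<bar>y u - y v\<bar> > 1))" for u v
  have P_sym: "P v u" if "P u v" for u v
    using that unfolding P_def insert_commute[of u v] abs_minus_commute[of "y u"] by metis
  have pair: "P (\<sigma> i) (\<sigma> k)" if "i < k" "k \<le> n" for i k
  proof -
    have xk: "i \<in> A \<Longrightarrow> k \<in> A \<Longrightarrow> x i < x k" "i \<notin> A \<Longrightarrow> k \<notin> A \<Longrightarrow> x i < x k"
      "i \<in> A \<Longrightarrow> k \<notin> A \<Longrightarrow> \<sigma> k < \<sigma> i \<Longrightarrow> \<bar>x i - x k\<bar> < 1"
      "i \<in> A \<Longrightarrow> k \<notin> A \<Longrightarrow> \<not> \<sigma> k < \<sigma> i \<Longrightarrow> x i + 1 < x k"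
      "i \<notin> A \<Longrightarrow> k \<in> A \<Longrightarrow> x i + 1 < x k"
      using x[of k i] that by simp_all
    have kA: "\<not> \<sigma> k < \<sigma> i" if "k \<in> A" using that \<open>i < k\<close> unfolding A_def by fastforce
    have B: "\<not> \<sigma> k < \<sigma> i" if "i \<notin> A" "k \<notin> A"
      using low that \<open>i < k\<close> by (fastforce simp: strict_mono_on_def)
    show ?thesis
      unfolding P_def mem y edge[OF \<open>i < k\<close>]
      by (cases "i \<in> A"; cases "k \<in> A") (use xk kA B in force)+
  qed
  have "unit_bigraph V E (\<sigma> ` A) y"
    unfolding unit_bigraph_def
    P_def[symmetric]
  proof (intro ballI impI)
    fix u v assume uv: "u \<in> V" "v \<in> V" "u \<noteq> v"
    then have "u \<in> \<sigma> ` {1..n}" "v \<in> \<sigma> ` {1..n}"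
      using permutes_image[OF \<sigma>] V by auto
    then obtain i k where ik: "u = \<sigma> i" "v = \<sigma> k" "i \<le> n" "k \<le> n"
      by auto
    then have "i < k \<or> k < i" using uv by (metis linorder_neqE_nat)
    then show "P u v"
      using pair P_sym ik by blast
  qed
  then show ?thesis using V by auto
qed

section \<open>Stable incidences\<close>

text \<open>Twice the signed area of the triangle \<open>a b c\<close>.\<close>

definition cross2 :: "real^2 \<Rightarrow> real^2 \<Rightarrow> real^2 \<Rightarrow> real" where
  "cross2 a b c = (b$1 - a$1) * (c$2 - a$2) - (b$2 - a$2) * (c$1 - a$1)"

text \<open>A proper crossing of two segments. The strict signs make the condition open, unlike mere
  intersection.\<close>

definition crossing :: "real^2 \<Rightarrow> real^2 \<Rightarrow> real^2 \<Rightarrow> real^2 \<Rightarrow> bool" where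
  "crossing a b c d \<longleftrightarrow> cross2 a b c * cross2 a b d < 0 \<and> cross2 c d a * cross2 c d b < 0"

lemma collinear_imp_cross2_eq_0:
  assumes "collinear {a, b, c}"
  shows "cross2 a b c = 0"
proof -
  obtain u where u: "\<forall>x\<in>{a,b,c}. \<forall>y\<in>{a,b,c}. \<exists>k. x - y = k *\<^sub>R u"
    using assms unfolding collinear_def by blast
  then obtain k l where "b - a = k *\<^sub>R u" "c - a = l *\<^sub>R u"
    by blast
  then have "b$1 - a$1 = k * u$1" "b$2 - a$2 = k * u$2" "c$1 - a$1 = l * u$1" "c$2 - a$2 = l * u$2"
    by (metis vector_minus_component vector_scaleR_component real_scaleR_def)+
  then show ?thesis
    by (simp add: cross2_def)
qed

text \<open>\<open>p / (p - q)\<close> is the zero of the affine function with value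
  \<open>p\<close> at 0 and \<open>q\<close> at 1.\<close>

lemma opposite_signs_divide:
  fixes p q :: real
  assumes "p * q < 0"
  shows "p \<noteq> q" "0 \<le> p / (p - q)" "p / (p - q) \<le> 1"
proof -
  have pq: "(p < 0 \<and> 0 < q) \<or> (0 < p \<and> q < 0)"
    using assms by (auto simp: mult_less_0_iff)
  then show "p \<noteq> q" "0 \<le> p / (p - q)" "p / (p - q) \<le> 1"
    by (auto simp: divide_simps)
qed

lemma crossing_imp_segments_meet:
  assumes "crossing a b c d"
  shows "closed_segment a b \<inter> closed_segment c d \<noteq> {}"
proof -
  define D where "D = cross2 a b c - cross2 a b d"
  have D': "cross2 c d a - cross2 c d b = - D"
    by (simp add: D_def cross2_def algebra_simps)
  \<comment> \<open>\<open>s\<close> is the parameter at which the segment \<open>c d\<close> meets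
    the line \<open>a b\<close>, and \<open>t\<close> the one at which \<open>a b\<close> meets the
    line \<open>c d\<close>.\<close>
  define s where "s = cross2 a b c / D"
  define t where "t = cross2 c d a / (cross2 c d a - cross2 c d b)"
  note c = opposite_signs_divide[of "cross2 a b c" "cross2 a b d"]
  note e = opposite_signs_divide[of "cross2 c d a" "cross2 c d b"]
  have D0: "D \<noteq> 0" and s: "0 \<le> s" "s \<le> 1"
    using c assms unfolding crossing_def s_def D_def by simp_all
  have t: "0 \<le> t" "t \<le> 1"
    using e assms unfolding crossing_def t_def by blast+
  have Dt: "D * t = - cross2 c d a"
    using D0 unfolding t_def D' by simp
  \<comment> \<open>After multiplication by \<open>D\<close>, equality of the two points is a
    polynomial identity in the coordinates.\<close>
  have "D * ((1 - s) * c$i + s * d$i) = D * ((1 - t) * a$i + t * b$i)" for i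
  proof -
    have "D * ((1 - s) * c$i + s * d$i) = (D - D * s) * c$i + (D * s) * d$i"
      by (simp add: algebra_simps)
    also have "D * s = cross2 a b c" using D0 by (simp add: s_def)
    also have "(D - cross2 a b c) * c$i + cross2 a b c * d$i
        = (D + cross2 c d a) * a$i + (- cross2 c d a) * b$i"
      using exhaust_2[of i] by (auto simp: D_def cross2_def algebra_simps)
    also have "- cross2 c d a = D * t" using Dt by simp
    also have "D + cross2 c d a = D - D * t" using Dt by simp
    finally show ?thesis by (simp add: algebra_simps)
  qed
  then have "(1 - s) *\<^sub>R c + s *\<^sub>R d = (1 - t) *\<^sub>R a + t *\<^sub>R b"
    using D0 by (simp add: vec_eq_iff)
  moreover have "(1 - t) *\<^sub>R a + t *\<^sub>R b \<in> closed_segment a b"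
    using t unfolding closed_segment_def by blast
  moreover have "(1 - s) *\<^sub>R c + s *\<^sub>R d \<in> closed_segment c d"
    using s unfolding closed_segment_def by blast
  ultimately show ?thesis by auto
qed

lemma tendsto_cross2 [tendsto_intros]:
  assumes "(f \<longlongrightarrow> a) F" "(g \<longlongrightarrow> b) F" "(h \<longlongrightarrow> c) F"
  shows "((\<lambda>x. cross2 (f x) (g x) (h x)) \<longlongrightarrow> cross2 a b c) F"
  unfolding cross2_def using assms by (intro tendsto_intros)

lemma eventually_crossing:
  assumes "(f \<longlongrightarrow> a) F" "(g \<longlongrightarrow> b) F" "(h \<longlongrightarrow> c) F" "(k \<longlongrightarrow> d) F" "crossing a b c d"
  shows "eventually (\<lambda>x. crossing (f x) (g x) (h x) (k x)) F"
proof -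
  have "((\<lambda>x. cross2 (f x) (g x) (h x) * cross2 (f x) (g x) (k x)) \<longlongrightarrow> cross2 a b c * cross2 a b d) F"
    "((\<lambda>x. cross2 (h x) (k x) (f x) * cross2 (h x) (k x) (g x)) \<longlongrightarrow> cross2 c d a * cross2 c d b) F"
    using assms by (auto intro!: tendsto_intros)
  then show ?thesis
    using assms(5) unfolding crossing_def by (auto intro!: eventually_conj dest: order_tendstoD(2))
qed

text \<open>A strictly separating hyperplane is certified by finitely many strict inequalities at
  the generating points, and these persist under small changes.\<close>

lemma eventually_convex_hulls_disjoint:
  fixes q :: "'i \<Rightarrow> 'b :: euclidean_space" and f :: "'c \<Rightarrow> 'i \<Rightarrow> 'b"
  assumes "finite S" "finite T" "convex hull (q ` S) \<inter> convex hull (q ` T) = {}"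
    and lim: "\<And>i. i \<in> S \<union> T \<Longrightarrow> ((\<lambda>e. f e i) \<longlongrightarrow> q i) F"
  shows "eventually (\<lambda>e. convex hull (f e ` S) \<inter> convex hull (f e ` T) = {}) F"
proof -
  have "compact (convex hull (q ` S))" "compact (convex hull (q ` T))"
    using assms(1,2) by (simp_all add: finite_imp_compact_convex_hull)
  then have "\<exists>n c. (\<forall>x\<in>convex hull (q ` S). n \<bullet> x < c) \<and> (\<forall>x\<in>convex hull (q ` T). c < n \<bullet> x)"
  proof (cases "T = {}")
    case True
    then show ?thesis using True by (intro exI[of _ 0] exI[of _ 1]) auto
  next
    case False
    then show ?thesis
      using separating_hyperplane_closed_compact[of "convex hull (q ` S)" "convex hull (q ` T)"] assms(2,3)
        \<open>compact (convex hull (q ` S))\<close> \<open>compact (convex hull (q ` T))\<close>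
      by (simp add: compact_imp_closed)
  qed
  then obtain n c where n: "\<forall>x\<in>convex hull (q ` S). n \<bullet> x < c" "\<forall>x\<in>convex hull (q ` T). c < n \<bullet> x"
    by blast
  have "eventually (\<lambda>e. n \<bullet> f e i < c) F" if "i \<in> S" for i
  proof (rule order_tendstoD(2))
    show "((\<lambda>e. n \<bullet> f e i) \<longlongrightarrow> n \<bullet> q i) F" using that lim by (auto intro!: tendsto_intros)
    show "n \<bullet> q i < c" using n(1) that by (simp add: hull_inc)
  qed
  moreover have "eventually (\<lambda>e. n \<bullet> f e i > c) F" if "i \<in> T" for i
  proof (rule order_tendstoD(1))
    show "((\<lambda>e. n \<bullet> f e i) \<longlongrightarrow> n \<bullet> q i) F" using that lim by (auto intro!: tendsto_intros)
    show "n \<bullet> q i > c" using n(2) that by (simp add: hull_inc)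
  qed
  ultimately have "eventually (\<lambda>e. (\<forall>i\<in>S. n \<bullet> f e i < c) \<and> (\<forall>i\<in>T. n \<bullet> f e i > c)) F"
    using assms(1,2) by (intro eventually_conj eventually_ball_finite) auto
  then show ?thesis
  proof eventually_elim
    case (elim e)
    have "convex hull (f e ` S) \<subseteq> {x. n \<bullet> x < c}"
      using elim by (intro hull_minimal convex_halfspace_lt) auto
    moreover have "convex hull (f e ` T) \<subseteq> {x. n \<bullet> x > c}"
      using elim by (intro hull_minimal convex_halfspace_gt) auto
    ultimately show ?case by force
  qed
qed

section \<open>Perturbation into general position\<close>

text \<open>The displacement is a scaled point of the moment curve \<open>(t, t^2)\<close>, on which
  no three distinct points are collinear.\<close>

definition moment_shift :: "('i \<Rightarrow> real^2) \<Rightarrow> ('i \<Rightarrow> real) \<Rightarrow> real \<Rightarrow> 'i \<Rightarrow> real^2" where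
  "moment_shift q t e i = q i + e *\<^sub>R vector [t i, (t i)\<^sup>2]"

lemma moment_shift_tendsto: "((\<lambda>e. moment_shift q t e i) \<longlongrightarrow> q i) (at_right 0)"
proof -
  have "((\<lambda>e. moment_shift q t e i) \<longlongrightarrow> q i + 0 *\<^sub>R vector [t i, (t i)\<^sup>2]) (at_right 0)"
    unfolding moment_shift_def by (intro tendsto_intros)
  then show ?thesis by simp
qed

lemma eventually_poly_neq_0:
  fixes p :: "real poly"
  assumes "p \<noteq> 0"
  shows "eventually (\<lambda>e. poly p e \<noteq> 0) (at_right 0)"
proof -
  have "finite {e. poly p e = 0}" using assms by (rule poly_roots_finite)
  then have "eventually (\<lambda>e. \<forall>r\<in>{e. poly p e = 0}. e \<noteq> r) (at_right 0)"
    by (intro eventually_ball_finite) (auto simp: eventually_neq_at_within)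
  then show ?thesis by eventually_elim auto
qed

text \<open>The cross product is quadratic in \<open>e\<close>, and its leading coefficient is the
  Vandermonde determinant of \<open>t i\<close>, \<open>t j\<close>, \<open>t k\<close>. Being
  nonzero, it suffices whatever the starting points are.\<close>

lemma eventually_cross2_moment_shift:
  assumes "t i \<noteq> t j" "t j \<noteq> t k" "t i \<noteq> t k"
  shows "eventually (\<lambda>e. cross2 (moment_shift q t e i) (moment_shift q t e j) (moment_shift q t e k) \<noteq> 0)
    (at_right 0)"
proof -
  define v where "v = (t j - t i) * (t k - t i) * (t k - t j)"
  define l where "l = (q j$1 - q i$1) * ((t k)\<^sup>2 - (t i)\<^sup>2) + (t j - t i) * (q k$2 - q i$2)
    - (q j$2 - q i$2) * (t k - t i) - ((t j)\<^sup>2 - (t i)\<^sup>2) * (q k$1 - q i$1)"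
  have poly: "poly [:cross2 (q i) (q j) (q k), l, v:] e =
    cross2 (moment_shift q t e i) (moment_shift q t e j) (moment_shift q t e k)" for e
    unfolding cross2_def moment_shift_def l_def v_def
    by (simp add: vector_2) algebra
  have "[:cross2 (q i) (q j) (q k), l, v:] \<noteq> 0"
    using assms by (simp add: v_def)
  then show ?thesis
    unfolding poly[symmetric] by (rule eventually_poly_neq_0)
qed

text \<open>The difference of the first coordinates is affine in \<open>e\<close> with nonzero
  slope.\<close>

lemma eventually_moment_shift_neq:
  assumes "t i \<noteq> t j"
  shows "eventually (\<lambda>e. moment_shift q t e i \<noteq> moment_shift q t e j) (at_right 0)"
proof -
  have "eventually (\<lambda>e. poly [:q i$1 - q j$1, t i - t j:] e \<noteq> 0) (at_right 0)"
    using assms by (intro eventually_poly_neq_0) simp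
  then show ?thesis
  proof eventually_elim
    case (elim e)
    then have "moment_shift q t e i $ 1 \<noteq> moment_shift q t e j $ 1"
      by (simp add: moment_shift_def vector_2 algebra_simps)
    then show ?case by metis
  qed
qed

lemma general_position_subset: "general_position S \<Longrightarrow> T \<subseteq> S \<Longrightarrow> general_position T"
  unfolding general_position_def by (meson order_trans)

lemma convex_polygon_convex_hull:
  assumes "general_position P" "S \<subseteq> P" "finite S" "card S \<ge> 3"
  shows "convex_polygon (convex hull S)"
proof -
  obtain T where T: "T \<subseteq> S" "card T = 3"
    using obtain_subset_with_card_n[OF assms(4)] by metis
  then have "\<not> collinear T"
    using assms(1,2) unfolding general_position_def by blast
  then have "\<not> collinear S"
    using T(1) collinear_subset by blast
  then have "aff_dim S > 1"
    by (simp add: collinear_aff_dim)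
  moreover have "aff_dim S \<le> 2"
    using aff_dim_le_DIM[of S] by simp
  ultimately show ?thesis
    unfolding convex_polygon_def using polytope_convex_hull[OF assms(3)] by (simp add: aff_dim_convex_hull)
qed

text \<open>Disjointness of compact convex hulls and proper crossings are open conditions, and along the
  moment curve every cross product becomes a nonzero polynomial in the perturbation parameter.\<close>

lemma obstacle_representation_of_degenerate:
  fixes pt :: "'v \<Rightarrow> 'i" and J :: "'k \<Rightarrow> 'i set" and q :: "'i \<Rightarrow> real^2"
  assumes fin: "finite V" "finite K" "\<And>k. k \<in> K \<Longrightarrow> finite (J k)"
    and pt: "inj_on pt V"
    and card_J: "\<And>k. k \<in> K \<Longrightarrow> card (J k) \<ge> 3"
    and edge: "\<And>u v k. u \<in> V \<Longrightarrow> v \<in> V \<Longrightarrow> u \<noteq> v \<Longrightarrow> {u, v} \<in> E \<Longrightarrow> k \<in> K \<Longrightarrow>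
      closed_segment (q (pt u)) (q (pt v)) \<inter> convex hull (q ` J k) = {}"
    and non_edge: "\<And>u v. u \<in> V \<Longrightarrow> v \<in> V \<Longrightarrow> u \<noteq> v \<Longrightarrow> {u, v} \<notin> E \<Longrightarrow>
      \<exists>k\<in>K. \<exists>i\<in>J k. \<exists>j\<in>J k. crossing (q (pt u)) (q (pt v)) (q i) (q j)"
    and disj: "\<And>k l. k \<in> K \<Longrightarrow> l \<in> K \<Longrightarrow> k \<noteq> l \<Longrightarrow>
      convex hull (q ` J k) \<inter> convex hull (q ` J l) = {}"
  shows "\<exists>p Obs. convex_obstacle_representation V E p Obs \<and> pairwise disjnt Obs \<and> card Obs \<le> card K"
proof -
  \<comment> \<open>All labels are perturbed together, each with its own parameter
    \<open>t i\<close>, so that even labels with the same position are separated.\<close>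
  define I where "I = pt ` V \<union> (\<Union>k\<in>K. J k)"
  have finI: "finite I" using fin by (auto simp: I_def)
  then obtain tn :: "'i \<Rightarrow> nat" where tn: "inj_on tn I"
    using finite_imp_inj_to_nat_seg by blast
  define t where "t i = real (tn i)" for i
  have t_neq: "t i \<noteq> t j" if "i \<in> I" "j \<in> I" "i \<noteq> j" for i j
    using tn that by (auto simp: t_def inj_on_def)
  define Q where "Q = moment_shift q t"
  have lim: "((\<lambda>e. Q e i) \<longlongrightarrow> q i) (at_right 0)" for i
    unfolding Q_def by (rule moment_shift_tendsto)
  have "eventually (\<lambda>e. \<forall>i\<in>I. \<forall>j\<in>I. \<forall>k\<in>I. i \<noteq> j \<longrightarrow> j \<noteq> k \<longrightarrow> i \<noteq> k \<longrightarrow>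
      cross2 (Q e i) (Q e j) (Q e k) \<noteq> 0) (at_right 0)"
    using finI t_neq unfolding Q_def
    by (intro eventually_ball_finite ballI) (simp_all add: eventually_cross2_moment_shift)
  moreover have "eventually (\<lambda>e. \<forall>i\<in>I. \<forall>j\<in>I. i \<noteq> j \<longrightarrow> Q e i \<noteq> Q e j) (at_right 0)"
    using finI t_neq unfolding Q_def
    by (intro eventually_ball_finite ballI) (simp_all add: eventually_moment_shift_neq)
  moreover have "eventually (\<lambda>e. \<forall>u\<in>V. \<forall>v\<in>V. \<forall>k\<in>K. u \<noteq> v \<longrightarrow> {u, v} \<in> E \<longrightarrow>
      convex hull (Q e ` {pt u, pt v}) \<inter> convex hull (Q e ` J k) = {}) (at_right 0)"
  proof (intro eventually_ball_finite ballI fin)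
    fix u v k assume uvk: "u \<in> V" "v \<in> V" "k \<in> K"
    show "eventually (\<lambda>e. u \<noteq> v \<longrightarrow> {u, v} \<in> E \<longrightarrow>
      convex hull (Q e ` {pt u, pt v}) \<inter> convex hull (Q e ` J k) = {}) (at_right 0)"
    proof (cases "u \<noteq> v \<and> {u, v} \<in> E")
      case True
      have "eventually (\<lambda>e. convex hull (Q e ` {pt u, pt v}) \<inter> convex hull (Q e ` J k) = {}) (at_right 0)"
        by (rule eventually_convex_hulls_disjoint[where q = q])
          (use True uvk fin edge lim in \<open>auto simp: segment_convex_hull\<close>)
      then show ?thesis by eventually_elim simp
    next
      case False
      then show ?thesis by auto
    qed
  qed
  moreover have "eventually (\<lambda>e. \<forall>u\<in>V. \<forall>v\<in>V. u \<noteq> v \<longrightarrow> {u, v} \<notin> E \<longrightarrow>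
      (\<exists>k\<in>K. \<exists>i\<in>J k. \<exists>j\<in>J k. crossing (Q e (pt u)) (Q e (pt v)) (Q e i) (Q e j))) (at_right 0)"
  proof (intro eventually_ball_finite ballI fin)
    fix u v assume uv: "u \<in> V" "v \<in> V"
    show "eventually (\<lambda>e. u \<noteq> v \<longrightarrow> {u, v} \<notin> E \<longrightarrow>
      (\<exists>k\<in>K. \<exists>i\<in>J k. \<exists>j\<in>J k. crossing (Q e (pt u)) (Q e (pt v)) (Q e i) (Q e j))) (at_right 0)"
    proof (cases "u \<noteq> v \<and> {u, v} \<notin> E")
      case True
      then obtain k i j where k: "k \<in> K" "i \<in> J k" "j \<in> J k"
        and c: "crossing (q (pt u)) (q (pt v)) (q i) (q j)"
        using non_edge uv by blast
      from eventually_crossing[OF lim lim lim lim c]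
      show ?thesis by eventually_elim (use k in blast)
    next
      case False
      then show ?thesis by auto
    qed
  qed
  moreover have "eventually (\<lambda>e. \<forall>k\<in>K. \<forall>l\<in>K. k \<noteq> l \<longrightarrow>
      convex hull (Q e ` J k) \<inter> convex hull (Q e ` J l) = {}) (at_right 0)"
  proof (intro eventually_ball_finite ballI fin)
    fix k l assume "k \<in> K" "l \<in> K"
    then show "eventually (\<lambda>e. k \<noteq> l \<longrightarrow>
      convex hull (Q e ` J k) \<inter> convex hull (Q e ` J l) = {}) (at_right 0)"
      using eventually_convex_hulls_disjoint[of "J k" "J l" q Q] fin disj lim
      by (cases "k = l") auto
  qed
  \<comment> \<open>Finitely many conditions, each valid for all small \<open>e > 0\<close>, hold
    for a common \<open>e\<close>.\<close>
  ultimately have "eventually (\<lambda>e.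
      (\<forall>i\<in>I. \<forall>j\<in>I. \<forall>k\<in>I. i \<noteq> j \<longrightarrow> j \<noteq> k \<longrightarrow> i \<noteq> k \<longrightarrow> cross2 (Q e i) (Q e j) (Q e k) \<noteq> 0) \<and>
      (\<forall>i\<in>I. \<forall>j\<in>I. i \<noteq> j \<longrightarrow> Q e i \<noteq> Q e j) \<and>
      (\<forall>u\<in>V. \<forall>v\<in>V. \<forall>k\<in>K. u \<noteq> v \<longrightarrow> {u, v} \<in> E \<longrightarrow>
        convex hull (Q e ` {pt u, pt v}) \<inter> convex hull (Q e ` J k) = {}) \<and>
      (\<forall>u\<in>V. \<forall>v\<in>V. u \<noteq> v \<longrightarrow> {u, v} \<notin> E \<longrightarrow>
        (\<exists>k\<in>K. \<exists>i\<in>J k. \<exists>j\<in>J k. crossing (Q e (pt u)) (Q e (pt v)) (Q e i) (Q e j))) \<and>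
      (\<forall>k\<in>K. \<forall>l\<in>K. k \<noteq> l \<longrightarrow> convex hull (Q e ` J k) \<inter> convex hull (Q e ` J l) = {})) (at_right 0)"
    (is "eventually (\<lambda>e. ?all (Q e)) _")
    by (intro eventually_conj)
  from eventually_happens'[OF trivial_limit_at_right_real this] obtain e where e: "?all (Q e)" ..
  define z where "z = Q e"
  note z = e[folded z_def]
  note noncol = z[THEN conjunct1, rule_format]
    and z_neq = z[THEN conjunct2, THEN conjunct1, rule_format]
    and z_edge = z[THEN conjunct2, THEN conjunct2, THEN conjunct1, rule_format]
    and z_non_edge = z[THEN conjunct2, THEN conjunct2, THEN conjunct2, THEN conjunct1, rule_format]
    and z_disj = z[THEN conjunct2, THEN conjunct2, THEN conjunct2, THEN conjunct2, rule_format]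
  have z_inj: "inj_on z I" using z_neq by (auto simp: inj_on_def)
  define Obs where "Obs = (\<lambda>k. convex hull (z ` J k)) ` K"
  have gp: "general_position (z ` I)"
    unfolding general_position_def
  proof (intro allI impI)
    fix T assume T: "T \<subseteq> z ` I" "card T = 3"
    then obtain a b c where abc: "T = {a, b, c}" "a \<noteq> b" "b \<noteq> c" "a \<noteq> c"
      by (metis card_3_iff)
    then obtain i j k where "a = z i" "b = z j" "c = z k" "i \<in> I" "j \<in> I" "k \<in> I"
      using T(1) by auto
    then show "\<not> collinear T"
      using noncol[of i j k] abc collinear_imp_cross2_eq_0 by metis
  qed
  have JI: "J k \<subseteq> I" if "k \<in> K" for k using that by (auto simp: I_def)
  have "convex_polygon (convex hull (z ` J k))" if "k \<in> K" for k
  proof (rule convex_polygon_convex_hull[OF gp])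
    show "3 \<le> card (z ` J k)"
      using card_J[OF that] card_image[OF inj_on_subset[OF z_inj JI[OF that]]] by simp
  qed (use that JI fin in auto)
  moreover have "inj_on (z \<circ> pt) V"
    using pt z_inj by (auto simp: I_def inj_on_def)
  moreover have "general_position ((z \<circ> pt) ` V \<union> (\<Union>P\<in>Obs. polygon_vertices P))"
  proof -
    \<comment> \<open>Extreme points of a hull are among its generators, so labels in the interior
      of an obstacle do no harm.\<close>
    have "polygon_vertices (convex hull (z ` J k)) \<subseteq> z ` I" if "k \<in> K" for k
      using extreme_points_of_convex_hull[of "z ` J k"] JI[OF that]
      unfolding polygon_vertices_def by blast
    moreover have "(z \<circ> pt) ` V \<subseteq> z ` I" by (auto simp: I_def)
    ultimately have "(z \<circ> pt) ` V \<union> (\<Union>P\<in>Obs. polygon_vertices P) \<subseteq> z ` I"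
      unfolding Obs_def by blast
    then show ?thesis using general_position_subset[OF gp] by blast
  qed
  moreover have "{u, v} \<in> E \<longleftrightarrow> (\<forall>P\<in>Obs. closed_segment ((z \<circ> pt) u) ((z \<circ> pt) v) \<inter> P = {})"
    if uv: "u \<in> V" "v \<in> V" "u \<noteq> v" for u v
  proof (cases "{u, v} \<in> E")
    case True
    then show ?thesis
      using z_edge[OF uv(1,2) _ uv(3)] by (auto simp: Obs_def segment_convex_hull)
  next
    case False
    then obtain k i j where k: "k \<in> K" "i \<in> J k" "j \<in> J k"
      and c: "crossing (z (pt u)) (z (pt v)) (z i) (z j)"
      using z_non_edge uv by blast
    have "closed_segment (z i) (z j) \<subseteq> convex hull (z ` J k)"
      unfolding segment_convex_hull by (rule hull_mono) (use k in auto)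
    then have "closed_segment (z (pt u)) (z (pt v)) \<inter> convex hull (z ` J k) \<noteq> {}"
      using crossing_imp_segments_meet[OF c] by blast
    then show ?thesis using False k by (auto simp: Obs_def)
  qed
  ultimately have "convex_obstacle_representation V E (z \<circ> pt) Obs"
    using fin unfolding convex_obstacle_representation_def by (auto simp: Obs_def)
  moreover have "pairwise disjnt Obs"
    using z_disj unfolding pairwise_def disjnt_def Obs_def by blast
  moreover have "card Obs \<le> card K"
    unfolding Obs_def using fin by (intro card_image_le) auto
  ultimately show ?thesis by blast
qed

section \<open>Placement on two parabolas\<close>

lemma cross2_uminus [simp]: "cross2 (- a) (- b) (- c) = cross2 a b c"
  by (simp add: cross2_def algebra_simps)

lemma crossing_uminus [simp]: "crossing (- a) (- b) (- c) (- d) \<longleftrightarrow> crossing a b c d"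
  by (simp add: crossing_def)

lemma crossing_commute: "crossing a b c d \<longleftrightarrow> crossing b a c d"
proof -
  have "cross2 b a p = - cross2 a b p" for p
    by (simp add: cross2_def algebra_simps)
  then show ?thesis by (simp add: crossing_def mult.commute)
qed

lemma convex_hull_halfplane:
  fixes S :: "(real^2) set"
  assumes "\<And>p. p \<in> S \<Longrightarrow> c < k * p$1 + l * p$2" "p \<in> convex hull S"
  shows "c < k * p$1 + l * p$2"
proof -
  have n: "vector [k, l] \<bullet> p = k * p$1 + l * p$2" for p :: "real^2"
    by (simp add: inner_vec_def sum_2 vector_2)
  have "convex {p :: real^2. c < k * p$1 + l * p$2}"
    using convex_halfspace_gt[of c "vector [k, l] :: real^2"] by (simp add: n)
  then have "convex hull S \<subseteq> {p. c < k * p$1 + l * p$2}"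
    using assms(1) by (intro hull_minimal) auto
  then show ?thesis using assms(2) by blast
qed

text \<open>The inequalities are weak on the segment, so the separating line may pass through one or
  both of its endpoints.\<close>

lemma segment_hull_disjoint:
  fixes u v :: "real^2"
  assumes "k * u$1 + l * u$2 \<le> c" "k * v$1 + l * v$2 \<le> c"
    and "\<And>p. p \<in> S \<Longrightarrow> c < k * p$1 + l * p$2"
  shows "closed_segment u v \<inter> convex hull S = {}"
proof (rule equals0I)
  fix p assume p: "p \<in> closed_segment u v \<inter> convex hull S"
  then obtain t where t: "0 \<le> t" "t \<le> 1" "p = (1 - t) *\<^sub>R u + t *\<^sub>R v"
    unfolding closed_segment_def by blast
  have "k * p$1 + l * p$2 = (1 - t) * (k * u$1 + l * u$2) + t * (k * v$1 + l * v$2)"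
    unfolding t(3) by (simp add: algebra_simps)
  also have "\<dots> \<le> c"
    by (rule convex_bound_le) (use assms t in auto)
  finally show False
    using convex_hull_halfplane[OF assms(3), where p = p] p by force
qed

text \<open>Sites are labels rather than points, so that the perturbation can move coincident points
  apart.\<close>

datatype 'a site = Vertex 'a | Cap real 'a 'a real | Apex real nat | Wall real nat

text \<open>The sign also serves as the scalar that reflects the upper parabola through the origin
  onto the lower one.\<close>

definition side :: "'a set \<Rightarrow> 'a \<Rightarrow> real" where
  "side A v = (if v \<in> A then 1 else - 1)"

text \<open>In \<open>site_pos A x M C\<close>, coincident and collinear sites are harmless because everything is
  perturbed afterwards; the index of \<open>Apex\<close> and \<open>Wall\<close> only serves to provide three sites.\<close>

primrec site_pos :: "'a set \<Rightarrow> ('a \<Rightarrow> real) \<Rightarrow> real \<Rightarrow> real \<Rightarrow> 'a site \<Rightarrow> real^2" where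
  "site_pos A x M C (Vertex v) = side A v *\<^sub>R vector [x v, M + (x v)\<^sup>2]"
| "site_pos A x M C (Cap s u v c) =
     s *\<^sub>R vector [(x u + x v) / 2, M + ((x u + x v) / 2)\<^sup>2 + c * (x u - x v)\<^sup>2]"
| "site_pos A x M C (Apex s n) = s *\<^sub>R vector [0, M + 1]"
| "site_pos A x M C (Wall s n) = s *\<^sub>R vector [if n = 0 then 1 / 2 else C, 0]"

text \<open>The pairs range over all of \<open>V\<close> and not only over one class: every such
  site still lies beyond the parabola of side \<open>s\<close>, so extra pairs do not spoil the
  cap.\<close>

definition cap_sites :: "'a set \<Rightarrow> ('a \<Rightarrow> real) \<Rightarrow> real \<Rightarrow> 'a site set" where
  "cap_sites V x s = Apex s ` {0, 1, 2} \<union>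
     (\<lambda>(u, v, c). Cap s u v c) ` {(u, v, c) \<in> V \<times> V \<times> {1/8, 3/8}. x u \<noteq> x v}"

definition wall_sites :: "real \<Rightarrow> 'a site set" where
  "wall_sites s = Wall s ` {0, 1, 2}"

lemma finite_cap_sites:
  assumes "finite V"
  shows "finite (cap_sites V x s)"
proof -
  have "finite {(u, v, c) \<in> V \<times> V \<times> {1/8, 3/8 :: real}. x u \<noteq> x v}"
    by (rule finite_subset[of _ "V \<times> V \<times> {1/8, 3/8}"]) (use assms in auto)
  then show ?thesis
    unfolding cap_sites_def by (intro finite_UnI finite_imageI) simp
qed

lemma finite_wall_sites: "finite (wall_sites s)"
  by (simp add: wall_sites_def)

lemma Cap_in_cap_sites:
  assumes "u \<in> V" "v \<in> V" "x u \<noteq> x v" "c \<in> {1/8, 3/8}"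
  shows "Cap s u v c \<in> cap_sites V x s"
  unfolding cap_sites_def by (intro UnI2 image_eqI[where x = "(u, v, c)"]) (use assms in auto)

lemma card_cap_sites: "finite V \<Longrightarrow> card (cap_sites V x s) \<ge> 3"
proof -
  assume "finite V"
  have "card (Apex s ` {0, 1, 2 :: nat} :: 'a site set) = 3"
    by (subst card_image) (auto simp: inj_on_def)
  then show ?thesis
    using card_mono[OF finite_cap_sites[OF \<open>finite V\<close>], of "Apex s ` {0, 1, 2}" x s]
    by (simp add: cap_sites_def)
qed

lemma card_wall_sites: "card (wall_sites s) \<ge> 3"
  unfolding wall_sites_def by (subst card_image) (auto simp: inj_on_def)

lemma cap_site_above_parabola:
  assumes "i \<in> cap_sites V x s"
  shows "\<exists>p q. site_pos A x M C i = s *\<^sub>R vector [p, q] \<and> q > M + p\<^sup>2"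
proof -
  consider n where "i = Apex s n"
    | u v c where "i = Cap s u v c" "x u \<noteq> x v" "c > 0"
    using assms unfolding cap_sites_def by fastforce
  then show ?thesis
  proof cases
    case 1
    then show ?thesis by (intro exI[of _ 0] exI[of _ "M + 1"]) simp
  next
    case 2
    then show ?thesis
      by (intro exI[of _ "(x u + x v) / 2"] exI[of _ "M + ((x u + x v) / 2)\<^sup>2 + c * (x u - x v)\<^sup>2"]) simp
  qed
qed

text \<open>The midpoint of a chord lies \<open>(x u - x v)^2 / 4\<close> above the parabola, and
  1/4 is between 1/8 and 3/8. The two cap sites thus form a vertical segment through that
  midpoint.\<close>

lemma crossing_cap:
  assumes s: "s = 1 \<or> s = - 1" and "x u \<noteq> x v" "side A u = s" "side A v = s"
  shows "crossing (site_pos A x M C (Vertex u)) (site_pos A x M C (Vertex v))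
    (site_pos A x M C (Cap s u v (1/8))) (site_pos A x M C (Cap s u v (3/8)))"
proof -
  define a b where "a = x u" and "b = x v"
  define m where "m = (a + b) / 2"
  define P Q R S :: "real^2" where
    "P = vector [a, M + a\<^sup>2]" and "Q = vector [b, M + b\<^sup>2]" and
    "R = vector [m, M + m\<^sup>2 + 1/8 * (a - b)\<^sup>2]" and "S = vector [m, M + m\<^sup>2 + 3/8 * (a - b)\<^sup>2]"
  have ab: "a - b \<noteq> 0" using assms by (simp add: a_def b_def)
  have "cross2 P Q R * cross2 P Q S = - ((a - b) ^ 3 / 8)\<^sup>2"
    unfolding cross2_def P_def Q_def R_def S_def m_def
    by (simp add: vector_2 field_simps) algebra
  moreover have "cross2 R S P * cross2 R S Q = - ((a - b) ^ 3 / 8)\<^sup>2"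
    unfolding cross2_def P_def Q_def R_def S_def m_def
    by (simp add: vector_2 field_simps) algebra
  moreover have "((a - b) ^ 3 / 8)\<^sup>2 > 0" using ab by simp
  ultimately have "crossing P Q R S" by (simp add: crossing_def)
  then show ?thesis
    using s assms by (auto simp: a_def b_def m_def P_def Q_def R_def S_def)
qed

text \<open>For \<open>s = 1\<close>, the expressions in \<open>near\<close> and \<open>far\<close>
  are the cross products of \<open>u\<close> and \<open>v\<close> with \<open>(1/2, 0)\<close> and
  \<open>(C, 0)\<close>. Their signs say that the segment meets the axis between these two
  points.\<close>

lemma crossing_wall:
  assumes s: "s = 1 \<or> s = - 1" and "side A u = s" "side A v = - s"
    and M: "M > 0" and C: "C > 1"
    and near: "(1/2 - x u) * (2 * M + (x u)\<^sup>2 + (x v)\<^sup>2) + (M + (x u)\<^sup>2) * (x u + x v) < 0"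
    and far: "(C - x u) * (2 * M + (x u)\<^sup>2 + (x v)\<^sup>2) + (M + (x u)\<^sup>2) * (x u + x v) > 0"
  shows "crossing (site_pos A x M C (Vertex u)) (site_pos A x M C (Vertex v))
    (site_pos A x M C (Wall s 0)) (site_pos A x M C (Wall s 1))"
proof -
  define a b where "a = x u" and "b = x v"
  define P Q R S :: "real^2" where
    "P = vector [a, M + a\<^sup>2]" and "Q = - vector [b, M + b\<^sup>2]" and
    "R = vector [1/2, 0]" and "S = vector [C, 0]"
  have "cross2 P Q R = (1/2 - a) * (2 * M + a\<^sup>2 + b\<^sup>2) + (M + a\<^sup>2) * (a + b)"
    "cross2 P Q S = (C - a) * (2 * M + a\<^sup>2 + b\<^sup>2) + (M + a\<^sup>2) * (a + b)"
    unfolding cross2_def P_def Q_def R_def S_def by (simp_all add: vector_2 algebra_simps)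
  then have "cross2 P Q R * cross2 P Q S < 0"
    using near far by (simp add: a_def b_def mult_neg_pos)
  moreover have "cross2 R S P = (C - 1/2) * (M + a\<^sup>2)" "cross2 R S Q = - ((C - 1/2) * (M + b\<^sup>2))"
    unfolding cross2_def P_def Q_def R_def S_def by (simp_all add: vector_2 algebra_simps)
  moreover have "(C - 1/2) * (M + a\<^sup>2) > 0" "(C - 1/2) * (M + b\<^sup>2) > 0"
    using M C by (intro mult_pos_pos; simp add: add_pos_nonneg)+
  ultimately have "crossing P Q R S"
    by (simp add: crossing_def mult_pos_neg)
  \<comment> \<open>Reflection through the origin reduces \<open>s = - 1\<close> to
    \<open>s = 1\<close>.\<close>
  moreover have "crossing P Q R S \<longleftrightarrow> crossing (- P) (- Q) (- R) (- S)" by simp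
  ultimately show ?thesis
    using s assms(2,3) unfolding P_def Q_def R_def S_def a_def b_def by auto
qed

lemma edge_misses_cap:
  assumes s: "s = 1 \<or> s = - 1" and "side A u = s" "side A v = - s"
    and M: "(x u)\<^sup>2 + 2 * x u * x v - (x v)\<^sup>2 \<le> 2 * M"
  shows "closed_segment (site_pos A x M C (Vertex u)) (site_pos A x M C (Vertex v)) \<inter>
    convex hull (site_pos A x M C ` cap_sites V x s) = {}"
  \<comment> \<open>separated by the tangent to the parabola at \<open>u\<close>\<close>
proof (rule segment_hull_disjoint[where k = "- 2 * s * x u" and l = s and c = "M - (x u)\<^sup>2"])
  show "- 2 * s * x u * site_pos A x M C (Vertex u) $ 1 + s * site_pos A x M C (Vertex u) $ 2 \<le> M - (x u)\<^sup>2"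
    using s assms(2) by (auto simp: vector_2 power2_eq_square)
  \<comment> \<open>As \<open>v\<close> lies on the opposite parabola, this is exactly assumption
    \<open>M\<close>.\<close>
  show "- 2 * s * x u * site_pos A x M C (Vertex v) $ 1 + s * site_pos A x M C (Vertex v) $ 2 \<le> M - (x u)\<^sup>2"
    using s assms(3) M by (auto simp: vector_2 power2_eq_square algebra_simps)
  fix z assume "z \<in> site_pos A x M C ` cap_sites V x s"
  then obtain p q where pq: "z = s *\<^sub>R vector [p, q]" "q > M + p\<^sup>2"
    using cap_site_above_parabola by blast
  have "(p - x u)\<^sup>2 \<ge> 0" by simp
  then have "M - (x u)\<^sup>2 < q - 2 * x u * p"
    using pq(2) by (simp add: power2_eq_square algebra_simps)
  then show "M - (x u)\<^sup>2 < - 2 * s * x u * z $ 1 + s * z $ 2"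
    using s by (auto simp: pq(1) vector_2 algebra_simps)
qed

lemma edge_misses_wall:
  assumes s: "s = 1 \<or> s = - 1" and "side A u = s" "side A v = - s"
    and near: "(1/2 - x u) * (2 * M + (x u)\<^sup>2 + (x v)\<^sup>2) + (M + (x u)\<^sup>2) * (x u + x v) > 0"
    and far: "(C - x u) * (2 * M + (x u)\<^sup>2 + (x v)\<^sup>2) + (M + (x u)\<^sup>2) * (x u + x v) > 0"
  shows "closed_segment (site_pos A x M C (Vertex u)) (site_pos A x M C (Vertex v)) \<inter>
    convex hull (site_pos A x M C ` wall_sites s) = {}"
  \<comment> \<open>separated by the line through \<open>u\<close> and \<open>v\<close>\<close>
proof (rule segment_hull_disjoint[where k = "s * (2 * M + (x u)\<^sup>2 + (x v)\<^sup>2)"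
      and l = "- s * (x u + x v)"
      and c = "x u * (2 * M + (x u)\<^sup>2 + (x v)\<^sup>2) - (M + (x u)\<^sup>2) * (x u + x v)"])
  show "s * (2 * M + (x u)\<^sup>2 + (x v)\<^sup>2) * site_pos A x M C (Vertex u) $ 1
      + - s * (x u + x v) * site_pos A x M C (Vertex u) $ 2
    \<le> x u * (2 * M + (x u)\<^sup>2 + (x v)\<^sup>2) - (M + (x u)\<^sup>2) * (x u + x v)"
    using s assms(2) by (auto simp: vector_2 algebra_simps)
  show "s * (2 * M + (x u)\<^sup>2 + (x v)\<^sup>2) * site_pos A x M C (Vertex v) $ 1
      + - s * (x u + x v) * site_pos A x M C (Vertex v) $ 2
    \<le> x u * (2 * M + (x u)\<^sup>2 + (x v)\<^sup>2) - (M + (x u)\<^sup>2) * (x u + x v)"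
    using s assms(3) by (auto simp: vector_2 algebra_simps)
  fix z assume "z \<in> site_pos A x M C ` wall_sites s"
  then have "z = s *\<^sub>R vector [1/2, 0] \<or> z = s *\<^sub>R vector [C, 0]"
    by (auto simp: wall_sites_def)
  then show "x u * (2 * M + (x u)\<^sup>2 + (x v)\<^sup>2) - (M + (x u)\<^sup>2) * (x u + x v)
    < s * (2 * M + (x u)\<^sup>2 + (x v)\<^sup>2) * z $ 1 + - s * (x u + x v) * z $ 2"
    using s near far by (auto simp: vector_2 algebra_simps)
qed

text \<open>The caps lie beyond the two lines at height \<open>M\<close> and \<open>- M\<close>,
  which separates them from each other and from the walls.\<close>

lemma cap_hull_beyond:
  assumes s: "s = 1 \<or> s = - 1" and "z \<in> convex hull (site_pos A x M C ` cap_sites V x s)"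
  shows "M < s * z$2"
proof -
  have "M < 0 * z$1 + s * z$2"
  proof (rule convex_hull_halfplane[OF _ assms(2)])
    fix z assume "z \<in> site_pos A x M C ` cap_sites V x s"
    then obtain p q where z: "z = s *\<^sub>R vector [p, q]" "q > M + p\<^sup>2"
      using cap_site_above_parabola by blast
    then have "M < q"
      using zero_le_power2[of p] by linarith
    then show "M < 0 * z$1 + s * z$2"
      using s z(1) by (auto simp: vector_2)
  qed
  then show ?thesis by simp
qed

text \<open>The walls stay strictly between the heights \<open>- M\<close> and \<open>M\<close>, on
  opposite sides of the vertical axis.\<close>

lemma wall_hull_bounds:
  assumes s: "s = 1 \<or> s = - 1" and MC: "M > 0" "C > 0"
    and z: "z \<in> convex hull (site_pos A x M C ` wall_sites s)"
  shows "0 < s * z$1" "\<bar>z$2\<bar> < M"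
proof -
  have w: "p = s *\<^sub>R vector [1/2, 0] \<or> p = s *\<^sub>R vector [C, 0]"
    if "p \<in> site_pos A x M C ` wall_sites s" for p
    using that by (auto simp: wall_sites_def)
  have "0 < s * z$1 + 0 * z$2"
    by (rule convex_hull_halfplane[OF _ z], drule w) (use s MC in \<open>auto simp: vector_2\<close>)
  then show "0 < s * z$1" by simp
  have "- M < 0 * z$1 + 1 * z$2"
    by (rule convex_hull_halfplane[OF _ z], drule w) (use s MC in \<open>auto simp: vector_2\<close>)
  moreover have "- M < 0 * z$1 + (- 1) * z$2"
    by (rule convex_hull_halfplane[OF _ z], drule w) (use s MC in \<open>auto simp: vector_2\<close>)
  ultimately show "\<bar>z$2\<bar> < M" by simp
qed

section \<open>Choice of the constants\<close>

lemma eventually_at_top_affine_pos: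
  fixes p q :: real
  assumes "p > 0"
  shows "eventually (\<lambda>M. 0 < M * p + q) at_top"
  using eventually_gt_at_top[of "- q / p"]
proof eventually_elim
  case (elim M)
  then have "- q < M * p" using pos_divide_less_eq[OF assms] by blast
  then show ?case by simp
qed

lemma unit_bigraph_constants:
  fixes x :: "'a \<Rightarrow> real"
  assumes fin: "finite V"
  obtains M C where "M > 0" "C > 1"
    "\<And>u v. u \<in> V \<Longrightarrow> v \<in> V \<Longrightarrow> (x u)\<^sup>2 + 2 * x u * x v - (x v)\<^sup>2 \<le> 2 * M"
    "\<And>u v. u \<in> V \<Longrightarrow> v \<in> V \<Longrightarrow> x u - x v < 1 \<Longrightarrow>
      (1/2 - x u) * (2 * M + (x u)\<^sup>2 + (x v)\<^sup>2) + (M + (x u)\<^sup>2) * (x u + x v) > 0"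
    "\<And>u v. u \<in> V \<Longrightarrow> v \<in> V \<Longrightarrow> x u - x v > 1 \<Longrightarrow>
      (1/2 - x u) * (2 * M + (x u)\<^sup>2 + (x v)\<^sup>2) + (M + (x u)\<^sup>2) * (x u + x v) < 0"
    "\<And>u v. u \<in> V \<Longrightarrow> v \<in> V \<Longrightarrow>
      (C - x u) * (2 * M + (x u)\<^sup>2 + (x v)\<^sup>2) + (M + (x u)\<^sup>2) * (x u + x v) > 0"
proof -
  \<comment> \<open>\<open>C\<close> exceeds every \<open>\<bar>x v\<bar>\<close>, hence every
    \<open>(x u - x v) / 2\<close>. It does not depend on \<open>M\<close>, which is chosen
    afterwards.\<close>
  define C where "C = 2 + (\<Sum>v\<in>V. \<bar>x v\<bar>)"
  have le: "\<bar>x v\<bar> \<le> C - 2" if "v \<in> V" for v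
    unfolding C_def using member_le_sum[of v V "\<lambda>v. \<bar>x v\<bar>"] that fin by simp
  have "0 \<le> (\<Sum>v\<in>V. \<bar>x v\<bar>)" by (rule sum_nonneg) simp
  then have C1: "C > 1" unfolding C_def by linarith
  \<comment> \<open>For fixed \<open>d\<close> the expression is affine in \<open>M\<close>, so for
    large \<open>M\<close> a nonzero slope \<open>2 * d - (a - b)\<close> decides its sign. For
    \<open>d = 1/2\<close> the slope compares \<open>a - b\<close> with 1.\<close>
  have expand: "(d - a) * (2 * M + a\<^sup>2 + b\<^sup>2) + (M + a\<^sup>2) * (a + b) =
    M * (2 * d - (a - b)) + ((d - a) * (a\<^sup>2 + b\<^sup>2) + a\<^sup>2 * (a + b))" for d a b M :: real
    by (simp add: algebra_simps)
  let ?g = "\<lambda>d M a b. (d - a) * (2 * M + a\<^sup>2 + b\<^sup>2) + (M + a\<^sup>2) * (a + b) :: real"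
  have pos: "eventually (\<lambda>M. ?g d M a b > 0) at_top" if "2 * d - (a - b) > 0" for d a b
    unfolding expand using that by (rule eventually_at_top_affine_pos)
  have neg: "eventually (\<lambda>M. ?g d M a b < 0) at_top" if "2 * d - (a - b) < 0" for d a b
  proof -
    have "eventually (\<lambda>M. 0 < M * - (2 * d - (a - b)) + - ((d - a) * (a\<^sup>2 + b\<^sup>2) + a\<^sup>2 * (a + b))) at_top"
      using that by (intro eventually_at_top_affine_pos) simp
    then show ?thesis unfolding expand by eventually_elim linarith
  qed
  have "eventually (\<lambda>M. \<forall>u\<in>V. \<forall>v\<in>V. (x u)\<^sup>2 + 2 * x u * x v - (x v)\<^sup>2 \<le> 2 * M) at_top"
  proof (intro eventually_ball_finite ballI fin)
    fix u v
    show "eventually (\<lambda>M. (x u)\<^sup>2 + 2 * x u * x v - (x v)\<^sup>2 \<le> 2 * M) at_top"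
      using eventually_ge_at_top[of "((x u)\<^sup>2 + 2 * x u * x v - (x v)\<^sup>2) / 2"]
      by eventually_elim simp
  qed
  moreover have "eventually (\<lambda>M. \<forall>u\<in>V. \<forall>v\<in>V. x u - x v < 1 \<longrightarrow> ?g (1/2) M (x u) (x v) > 0) at_top"
    using pos[of "1/2"] by (intro eventually_ball_finite ballI fin) (simp add: eventually_mono)
  moreover have "eventually (\<lambda>M. \<forall>u\<in>V. \<forall>v\<in>V. x u - x v > 1 \<longrightarrow> ?g (1/2) M (x u) (x v) < 0) at_top"
    using neg[of "1/2"] by (intro eventually_ball_finite ballI fin) (simp add: eventually_mono)
  moreover have "eventually (\<lambda>M. \<forall>u\<in>V. \<forall>v\<in>V. ?g C M (x u) (x v) > 0) at_top"
  proof (intro eventually_ball_finite ballI fin pos)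
    fix u v assume "u \<in> V" "v \<in> V"
    then show "2 * C - (x u - x v) > 0" using le[of u] le[of v] by linarith
  qed
  moreover have "eventually (\<lambda>M::real. M > 0) at_top" by (rule eventually_gt_at_top)
  ultimately have "eventually (\<lambda>M.
      (\<forall>u\<in>V. \<forall>v\<in>V. (x u)\<^sup>2 + 2 * x u * x v - (x v)\<^sup>2 \<le> 2 * M) \<and>
      (\<forall>u\<in>V. \<forall>v\<in>V. x u - x v < 1 \<longrightarrow> ?g (1/2) M (x u) (x v) > 0) \<and>
      (\<forall>u\<in>V. \<forall>v\<in>V. x u - x v > 1 \<longrightarrow> ?g (1/2) M (x u) (x v) < 0) \<and>
      (\<forall>u\<in>V. \<forall>v\<in>V. ?g C M (x u) (x v) > 0) \<and> M > 0) at_top"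
    by (intro eventually_conj)
  from eventually_happens'[OF _ this] obtain M where "
      (\<forall>u\<in>V. \<forall>v\<in>V. (x u)\<^sup>2 + 2 * x u * x v - (x v)\<^sup>2 \<le> 2 * M) \<and>
      (\<forall>u\<in>V. \<forall>v\<in>V. x u - x v < 1 \<longrightarrow> ?g (1/2) M (x u) (x v) > 0) \<and>
      (\<forall>u\<in>V. \<forall>v\<in>V. x u - x v > 1 \<longrightarrow> ?g (1/2) M (x u) (x v) < 0) \<and>
      (\<forall>u\<in>V. \<forall>v\<in>V. ?g C M (x u) (x v) > 0) \<and> M > 0"
    by auto
  then show ?thesis
    by (elim conjE) (rule that[of M C]; use C1 in simp)
qed

lemma unit_bigraph_obstacle_representation:
  assumes fin: "finite V" and G: "unit_bigraph V E A x"
  shows "\<exists>p Obs. convex_obstacle_representation V E p Obs \<and> pairwise disjnt Obs \<and> card Obs \<le> 4"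
proof -
  obtain M C where M: "M > 0" and C: "C > 1"
    and tangent: "\<And>u v. u \<in> V \<Longrightarrow> v \<in> V \<Longrightarrow> (x u)\<^sup>2 + 2 * x u * x v - (x v)\<^sup>2 \<le> 2 * M"
    and left: "\<And>u v. u \<in> V \<Longrightarrow> v \<in> V \<Longrightarrow> x u - x v < 1 \<Longrightarrow>
      (1/2 - x u) * (2 * M + (x u)\<^sup>2 + (x v)\<^sup>2) + (M + (x u)\<^sup>2) * (x u + x v) > 0"
    and right: "\<And>u v. u \<in> V \<Longrightarrow> v \<in> V \<Longrightarrow> x u - x v > 1 \<Longrightarrow>
      (1/2 - x u) * (2 * M + (x u)\<^sup>2 + (x v)\<^sup>2) + (M + (x u)\<^sup>2) * (x u + x v) < 0"
    and far: "\<And>u v. u \<in> V \<Longrightarrow> v \<in> V \<Longrightarrow>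
      (C - x u) * (2 * M + (x u)\<^sup>2 + (x v)\<^sup>2) + (M + (x u)\<^sup>2) * (x u + x v) > 0"
    using unit_bigraph_constants[OF fin, of x] by blast
  define q where "q = site_pos A x M C"
  \<comment> \<open>One obstacle for each side and each kind, \<open>True\<close> standing for a cap
    and \<open>False\<close> for a wall.\<close>
  define K :: "(real \<times> bool) set" where "K = {1, - 1} \<times> {True, False}"
  define J :: "real \<times> bool \<Rightarrow> 'a site set" where
    "J k = (if snd k then cap_sites V x (fst k) else wall_sites (fst k))" for k
  have K: "fst k = 1 \<or> fst k = - 1" if "k \<in> K" for k using that by (auto simp: K_def)
  have side: "side A v = 1 \<or> side A v = - 1" for v by (simp add: side_def)
  have "\<exists>p Obs. convex_obstacle_representation V E p Obs \<and> pairwise disjnt Obs \<and> card Obs \<le> card K"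
  proof (rule obstacle_representation_of_degenerate[where pt = Vertex and J = J and q = q])
    show "finite V" by fact
    show "finite K" by (simp add: K_def)
    show "inj_on Vertex V" by (simp add: inj_on_def)
    show "finite (J k)" for k
      using fin by (simp add: J_def finite_cap_sites finite_wall_sites)
    show "3 \<le> card (J k)" for k
      using fin by (simp add: J_def card_cap_sites card_wall_sites)
  next
    \<comment> \<open>The obstacle is compared with the endpoint on its own side, called
      \<open>u\<close>; every edge has exactly one such endpoint.\<close>
    have oriented: "closed_segment (q (Vertex u)) (q (Vertex v)) \<inter> convex hull (q ` J k) = {}"
      if uv: "u \<in> V" "v \<in> V" "\<bar>x u - x v\<bar> < 1" "side A u = fst k" "side A v = - fst k" and k: "k \<in> K"
      for u v k
    proof (cases "snd k")
      case True
      then show ?thesis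
        using edge_misses_cap[OF K[OF k] uv(4,5) tangent[OF uv(1,2)]] by (simp add: q_def J_def)
    next
      case False
      have "x u - x v < 1" using uv(3) by simp
      then show ?thesis
        using edge_misses_wall[OF K[OF k] uv(4,5) left[OF uv(1,2)] far[OF uv(1,2)]] False
        by (simp add: q_def J_def)
    qed
    fix u v k assume uv: "u \<in> V" "v \<in> V" "u \<noteq> v" and e: "{u, v} \<in> E" and k: "k \<in> K"
    then have "\<not> (u \<in> A \<longleftrightarrow> v \<in> A)" "\<bar>x u - x v\<bar> < 1"
      using G unfolding unit_bigraph_def by metis+
    moreover from this have "side A u = fst k \<and> side A v = - fst k \<or> side A v = fst k \<and> side A u = - fst k"
      using K[OF k] by (auto simp: side_def)
    ultimately show "closed_segment (q (Vertex u)) (q (Vertex v)) \<inter> convex hull (q ` J k) = {}"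
      using oriented[of u v k] oriented[of v u k] uv k
      by (auto simp: closed_segment_commute abs_minus_commute)
  next
    fix u v assume uv: "u \<in> V" "v \<in> V" "u \<noteq> v" and e: "{u, v} \<notin> E"
    \<comment> \<open>The endpoint with the larger coordinate is taken as \<open>u\<close>, and the
      wall on its side blocks the pair.\<close>
    have wall: "\<exists>k\<in>K. \<exists>i\<in>J k. \<exists>j\<in>J k. crossing (q (Vertex u)) (q (Vertex v)) (q i) (q j)"
      if uv: "u \<in> V" "v \<in> V" "x u - x v > 1" "side A v = - side A u" for u v
    proof (intro bexI)
      show "crossing (q (Vertex u)) (q (Vertex v)) (q (Wall (side A u) 0)) (q (Wall (side A u) 1))"
        unfolding q_def
        using crossing_wall[OF side refl uv(4) M C right[OF uv(1,2,3)] far[OF uv(1,2)]] .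
      show "Wall (side A u) 0 \<in> J (side A u, False)" "Wall (side A u) 1 \<in> J (side A u, False)"
        by (simp_all add: J_def wall_sites_def)
      show "(side A u, False) \<in> K" using side[of u] by (auto simp: K_def)
    qed
    show "\<exists>k\<in>K. \<exists>i\<in>J k. \<exists>j\<in>J k. crossing (q (Vertex u)) (q (Vertex v)) (q i) (q j)"
    proof (cases "u \<in> A \<longleftrightarrow> v \<in> A")
      case True
      then have neq: "x u \<noteq> x v" and "side A v = side A u"
        using G uv unfolding unit_bigraph_def by (blast, simp add: side_def)
      show ?thesis
      proof (intro bexI)
        show "crossing (q (Vertex u)) (q (Vertex v))
          (q (Cap (side A u) u v (1/8))) (q (Cap (side A u) u v (3/8)))"
          unfolding q_def by (rule crossing_cap) (use side neq \<open>side A v = side A u\<close> in auto)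
        show "Cap (side A u) u v (1/8) \<in> J (side A u, True)" "Cap (side A u) u v (3/8) \<in> J (side A u, True)"
          using uv neq by (simp_all add: J_def Cap_in_cap_sites)
        show "(side A u, True) \<in> K" using side[of u] by (auto simp: K_def)
      qed
    next
      case False
      then have "x u - x v > 1 \<or> x v - x u > 1"
        using G uv e unfolding unit_bigraph_def by (smt (verit))
      moreover have "side A v = - side A u" "side A u = - side A v"
        using False by (auto simp: side_def)
      ultimately show ?thesis
        using wall[of u v] wall[of v u] uv crossing_commute by blast
    qed
  next
    have cap: "M < s * z$2" if "s = 1 \<or> s = - 1" "z \<in> convex hull (q ` cap_sites V x s)" for s z
      using cap_hull_beyond that unfolding q_def by blast
    have wall: "0 < s * z$1" "\<bar>z$2\<bar> < M" if "s = 1 \<or> s = - 1" "z \<in> convex hull (q ` wall_sites s)" for s z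
      using wall_hull_bounds[of s M C z A x] that M C unfolding q_def by auto
    fix k l assume kl: "k \<in> K" "l \<in> K" "k \<noteq> l"
    show "convex hull (q ` J k) \<inter> convex hull (q ` J l) = {}"
    proof (rule equals0I)
      fix z assume z: "z \<in> convex hull (q ` J k) \<inter> convex hull (q ` J l)"
      have info: "if snd m then M < fst m * z$2 else 0 < fst m * z$1 \<and> \<bar>z$2\<bar> < M"
        if "m \<in> K" "z \<in> convex hull (q ` J m)" for m
        using cap[of "fst m" z] wall[of "fst m" z] K[OF that(1)] that(2) by (simp add: J_def split: if_splits)
      have "if snd k then M < fst k * z$2 else 0 < fst k * z$1 \<and> \<bar>z$2\<bar> < M"
        "if snd l then M < fst l * z$2 else 0 < fst l * z$1 \<and> \<bar>z$2\<bar> < M"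
        using info kl z by blast+
      then show False
        using kl M unfolding K_def by (auto split: if_splits)
    qed
  qed
  moreover have "card K = 4" by (simp add: K_def card_cartesian_product)
  ultimately show ?thesis by simp
qed

theorem theorem3:
  fixes V :: "nat set" and E :: "nat set set"
  assumes "bipartite_permutation_graph V E"
  shows "convex_obstacle_number V E \<le> 4 \<and> disjoint_convex_obstacle_number V E \<le> 4"
proof -
  \<comment> \<open>A single representation with disjoint obstacles bounds both infima.\<close>
  obtain p Obs where rep: "convex_obstacle_representation V E p Obs"
    and disj: "pairwise disjnt Obs" and card: "card Obs \<le> 4"
    using bipartite_permutation_graph_imp_unit_bigraph[OF assms] unit_bigraph_obstacle_representation
    by blast
  have "convex_obstacle_number V E \<le> enat (card Obs)"
    unfolding convex_obstacle_number_def using rep by (intro Inf_lower) blast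
  moreover have "disjoint_convex_obstacle_number V E \<le> enat (card Obs)"
    unfolding disjoint_convex_obstacle_number_def using rep disj by (intro Inf_lower) blast
  moreover have "enat (card Obs) \<le> 4"
    using card by (simp add: numeral_eq_enat)
  ultimately show ?thesis by (meson order_trans)
qed

end
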